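(* If $p$ is prime then $\frac{n_{2p}}{2p}$ is an integer if and only if $2b(p)=b(3p-1)+1$. Moreover, the only primes $p$ which satisfy this condition are those that are well-spaced.
   Context: For a positive integer $r$ define the rational number $$n_r = r^{-2}\sum_{d\mid r}\mu\left(\frac rd\right)\binom{3d-1}{d-1},$$ where the sum is over positive divisors $d$ of $r$ and $\mu$ is the Möbius function. For a nonnegative integer $t$, $b(t)$ denotes the sum of the binary digits of $t$, i.e. the number of ones in the expression of $t$ in base 2. A number $m=\sum_{j=0}^J\epsilon_j2^j$ with $\epsilon_j\in\{0,1\}$ is called (binarily) well-spaced if and only if $\epsilon_j\epsilon_{j+1}=0$ for $j=0,1,\dots,J-1$, i.e. its binary expansion does not have consecutive 1's. *)

theory Defs
  imports Complex_Main "HOL-Computational_Algebra.Computational_Algebra"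
begin

definition moebius_mu :: "nat \<Rightarrow> int" where
  "moebius_mu n = (if squarefree n then (-1) ^ card (prime_factors n) else 0)"

definition n_num :: "nat \<Rightarrow> rat" where
  "n_num r = (\<Sum>d | d dvd r. of_int (moebius_mu (r div d)) * of_nat ((3 * d - 1) choose (d - 1)))
               / of_nat r ^ 2"

definition binary_digit_sum :: "nat \<Rightarrow> nat" where
  "binary_digit_sum t = card {j. bit t j}"

definition well_spaced :: "nat \<Rightarrow> bool" where
  "well_spaced m \<longleftrightarrow> (\<forall>j. \<not> (bit m j \<and> bit m (Suc j)))"

end

theory Submission
  imports Defs "HOL-Number_Theory.Modular_Inverse"
begin

text \<open>
  Multiplying out the denominators, the quotient in question is an integer iff \<open>(2p)\<^sup>3\<close> divides the
  Moebius sum, which for an odd prime \<open>p\<close> is \<open>S = A - B - 4\<close> with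
  \<open>A = binom(6p-1, 2p-1) = binom(6p, 2p) / 3\<close> and \<open>B = binom(3p-1, p-1) = binom(3p, p) / 3\<close>.
  The factors \<open>p\<^sup>3\<close> and \<open>8\<close> are treated by the same device. For every \<open>q > 0\<close>, removing the multiples
  of \<open>q\<close> from \<open>(nq)!\<close> gives \<open>(nq)! = q\<^sup>n n! Q\<^sub>q(n)\<close>, where \<open>Q\<^sub>q\<close> is
  \<open>coprime_part q\<close>; so \<open>binom(mq, kq)\<close> and \<open>binom(m, k)\<close> differ only by the ratio \<open>Q\<^sub>q(m) / (Q\<^sub>q(k) Q\<^sub>q(m-k))\<close>
  (lemma \<open>binomial_mult_coprime_part\<close>).

  For \<open>q = p > 3\<close>, each block of \<open>p - 1\<close> consecutive factors of \<open>Q\<^sub>p\<close> is \<open>(p-1)!\<close> modulo \<open>p\<^sup>3\<close>, as in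
  Wolstenholme's theorem (\<open>block_cong\<close>). Hence \<open>binom(mp, kp)\<close> is congruent to \<open>binom(m, k)\<close>, so
  \<open>A\<close> is \<open>5\<close> and \<open>B\<close> is \<open>1\<close> modulo \<open>p\<^sup>3\<close>, and \<open>p\<^sup>3\<close> always divides \<open>S\<close>.

  For \<open>q = 2\<close>, \<open>Q\<^sub>2(n)\<close> is the product of the first \<open>n\<close> odd numbers, which modulo \<open>8\<close> depends only on
  \<open>n mod 4\<close>. For odd \<open>p\<close> this gives \<open>A = 5B\<close> modulo \<open>8\<close>, whence \<open>S = 4(B - 1)\<close> modulo \<open>8\<close>: integrality is
  equivalent to \<open>B\<close> being odd.

  Finally \<open>B\<close> has the parity of \<open>binom(2p + p, p)\<close>, which by Kummer's theorem at the prime \<open>2\<close> is odd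
  iff the binary addition of \<open>2p\<close> and \<open>p\<close> has no carry. As \<open>2p\<close> is \<open>p\<close> shifted by one digit, this says
  that \<open>p\<close> has no two adjacent ones; equally, it says that the digit sums add up, that is
  \<open>b(3p) = 2b(p)\<close>, where \<open>b(3p) = b(3p-1) + 1\<close> because \<open>3p\<close> is odd.

  The congruence modulo \<open>p\<^sup>3\<close> is not available for \<open>p = 3\<close>; but \<open>3\<close> is not well-spaced, so divisibility fails
  already at \<open>8\<close>. For \<open>p = 2\<close> the Moebius sum has another shape and is computed.
\<close>

section \<open>Splitting factorials modulo p\<close>

text \<open>
  The factors of a factorial that lie strictly between consecutive multiples of \<open>p\<close>; in particular
  \<open>block p 0 = (p - 1)!\<close>.
\<close>
definition block :: "nat \<Rightarrow> nat \<Rightarrow> nat" where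
  "block p j = (\<Prod>i\<in>{1..<p}. j * p + i)"

text \<open>
  The name fits prime \<open>p\<close>, where this is the product of all \<open>i \<le> n p\<close> coprime to \<open>p\<close>; for \<open>p = 2\<close> it is
  the double factorial \<open>(2n - 1)!!\<close>.
\<close>
definition coprime_part :: "nat \<Rightarrow> nat \<Rightarrow> nat" where
  "coprime_part p n = (\<Prod>j<n. block p j)"

lemma fact_add_eq_prod: "(fact (m + k) :: nat) = fact m * (\<Prod>i\<in>{1..<Suc k}. m + i)"
  by (induction k) (auto simp: algebra_simps)

lemma fact_mult_eq_coprime_part:
  assumes "p > 0"
  shows "(fact (n * p) :: nat) = p ^ n * fact n * coprime_part p n"
proof (induction n)
  case 0
  show ?case by (simp add: coprime_part_def)
next
  case (Suc n)
  have "(fact (Suc n * p) :: nat) = fact (n * p) * (\<Prod>i\<in>{1..<Suc p}. n * p + i)"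
    using fact_add_eq_prod[of "n * p" p] by (simp add: add.commute)
  also have "(\<Prod>i\<in>{1..<Suc p}. n * p + i) = block p n * (Suc n * p)"
    using assms by (simp add: block_def prod.atLeastLessThan_Suc algebra_simps)
  also have "fact (n * p) * (block p n * (Suc n * p)) = p ^ Suc n * fact (Suc n) * coprime_part p (Suc n)"
    unfolding Suc.IH coprime_part_def by (simp add: algebra_simps)
  finally show ?case .
qed

text \<open>
  In the quotient of three factorials the powers of \<open>p\<close> cancel and the factorials \<open>n!\<close> recombine to the
  smaller binomial coefficient. Keeping the identity in multiplied-out form lets it be read modulo any
  number coprime to the blocks.
\<close>
lemma binomial_mult_coprime_part:
  assumes "p > 0"
  shows "((m + k) * p choose (k * p)) * (coprime_part p k * coprime_part p m)
         = ((m + k) choose k) * coprime_part p (m + k)"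
proof -
  have eq: "fact (k * p) * fact (m * p) * ((m + k) * p choose (k * p)) = (fact ((m + k) * p) :: nat)"
    using binomial_fact_lemma[of "k * p" "(m + k) * p"] by (simp add: algebra_simps)
  have eq': "fact k * fact m * ((m + k) choose k) = (fact (m + k) :: nat)"
    using binomial_fact_lemma[of k "m + k"] by simp
  have "(p ^ (m + k) * fact k * fact m) *
          (((m + k) * p choose (k * p)) * (coprime_part p k * coprime_part p m)) =
        (p ^ (m + k) * fact k * fact m) * (((m + k) choose k) * coprime_part p (m + k))"
    using eq unfolding fact_mult_eq_coprime_part[OF assms] eq'[symmetric]
    by (simp add: power_add mult_ac)
  thus ?thesis
    using assms by simp
qed

section \<open>The congruence modulo the cube of a prime\<close>

lemma cong_prod_one_plus:
  fixes y :: int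
  assumes "finite A"
  shows "[(\<Prod>i\<in>A. 1 + y * b i) = 1 + y * (\<Sum>i\<in>A. b i)] (mod y\<^sup>2)"
  using assms
proof (induction A rule: finite_induct)
  case empty
  show ?case by simp
next
  case (insert a A)
  have "[(1 + y * b a) * (\<Prod>i\<in>A. 1 + y * b i) = (1 + y * b a) * (1 + y * (\<Sum>i\<in>A. b i))] (mod y\<^sup>2)"
    by (intro cong_mult cong_refl insert.IH)
  also have "(1 + y * b a) * (1 + y * (\<Sum>i\<in>A. b i)) =
             1 + y * (b a + (\<Sum>i\<in>A. b i)) + y\<^sup>2 * (b a * (\<Sum>i\<in>A. b i))"
    by (simp add: algebra_simps power2_eq_square)
  also have "[\<dots> = 1 + y * (b a + (\<Sum>i\<in>A. b i))] (mod y\<^sup>2)"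
    by (simp add: cong_def)
  finally show ?case
    using insert.hyps by simp
qed

lemma sum_squares_below: "6 * (\<Sum>i\<in>{1..<Suc n}. int i ^ 2) = int n * (int n + 1) * (2 * int n + 1)"
  by (induction n) (auto simp: algebra_simps power2_eq_square)

text \<open>
  Inversion permutes the nonzero residues, so the sum is that of all squares, \<open>(p-1)p(2p-1)/6\<close>;
  the hypothesis \<open>p > 3\<close> makes the denominator \<open>6\<close> invertible. The values \<open>g i\<close> are arbitrary
  representatives because they arise as inverses modulo \<open>p\<^sup>3\<close>.
\<close>
lemma sum_inverse_squares_cong_0:
  fixes p :: nat and g :: "nat \<Rightarrow> int"
  assumes "prime p" "p > 3"
    and inv: "\<And>i. i \<in> {1..<p} \<Longrightarrow> [int i * g i = 1] (mod int p)"
  shows "[(\<Sum>i\<in>{1..<p}. (g i)\<^sup>2) = 0] (mod int p)"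
proof -
  \<comment> \<open>the representative of \<open>g i\<close> among the summation indices\<close>
  define h where "h i = nat (g i mod int p)" for i
  have h: "int (h i) = g i mod int p" for i
    using assms by (simp add: h_def)
  have inj: "inj_on h {1..<p}"
  proof (rule inj_onI)
    fix i k assume ik: "i \<in> {1..<p}" "k \<in> {1..<p}" "h i = h k"
    have gg: "[g i = g k] (mod int p)"
      using ik(3) h[of i] h[of k] by (simp add: cong_def)
    have "[int i * 1 = int i * (int k * g k)] (mod int p)"
      using inv[OF ik(2)] by (intro cong_mult) (auto simp: cong_sym)
    also have "[int i * (int k * g k) = int i * (int k * g i)] (mod int p)"
      using gg by (intro cong_mult cong_refl) (auto simp: cong_sym)
    also have "int i * (int k * g i) = int k * (int i * g i)"
      by simp
    also have "[\<dots> = int k * 1] (mod int p)"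
      using inv[OF ik(1)] by (intro cong_mult) auto
    finally show "i = k"
      using ik by (simp add: cong_int_iff cong_less_modulus_unique_nat)
  qed
  have "h ` {1..<p} \<subseteq> {1..<p}"
  proof (intro subsetI, elim imageE)
    fix x i assume x: "x = h i" and i: "i \<in> {1..<p}"
    have "int (h i) < int p"
      unfolding h using assms by simp
    moreover have "h i \<noteq> 0"
    proof
      assume "h i = 0"
      hence "int p dvd g i"
        using h[of i] by (simp add: dvd_eq_mod_eq_0)
      hence "[int i * g i = 0] (mod int p)"
        by (simp add: cong_0_iff)
      hence "[0 = 1] (mod int p)"
        using inv[OF i] by (meson cong_sym cong_trans)
      thus False
        using assms by (simp add: cong_def)
    qed
    ultimately show "x \<in> {1..<p}"
      by (simp add: x)
  qed
  hence img: "h ` {1..<p} = {1..<p}"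
    using inj by (intro endo_inj_surj) auto
  have "[(\<Sum>i\<in>{1..<p}. (g i)\<^sup>2) = (\<Sum>i\<in>{1..<p}. (int (h i))\<^sup>2)] (mod int p)"
    unfolding h by (intro cong_sum cong_pow) simp
  also have "(\<Sum>i\<in>{1..<p}. (int (h i))\<^sup>2) = (\<Sum>i\<in>h ` {1..<p}. (int i)\<^sup>2)"
    using inj by (simp add: sum.reindex)
  also have "\<dots> = (\<Sum>i\<in>{1..<p}. (int i)\<^sup>2)"
    by (simp only: img)
  also have "[\<dots> = 0] (mod int p)"
  proof -
    obtain n where n: "p = Suc n"
      using assms by (cases p) auto
    have "int p dvd 6 * (\<Sum>i\<in>{1..<p}. (int i)\<^sup>2)"
      unfolding n sum_squares_below by (simp add: add.commute)
    moreover have "coprime (int p) 6"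
    proof -
      have "coprime p 2" "coprime p 3"
        using assms(1,2) by (intro primes_coprime; simp)+
      hence "coprime p (2 * 3)"
        by (simp only: coprime_mult_right_iff)
      hence "coprime (int p) (int 6)"
        by (subst coprime_int_iff) simp
      thus ?thesis by simp
    qed
    ultimately show ?thesis
      by (simp add: coprime_dvd_mult_right_iff cong_0_iff)
  qed
  finally show ?thesis .
qed

lemma coprime_block:
  assumes "prime p"
  shows "coprime (block p j) p"
  unfolding block_def
proof (rule prod_coprime_left)
  fix i assume "i \<in> {1..<p}"
  hence "\<not> p dvd i"
    by (auto dest: dvd_imp_le)
  hence "\<not> p dvd j * p + i"
    by (simp add: dvd_add_right_iff)
  thus "coprime (j * p + i) p"
    using assms by (simp add: prime_imp_coprime coprime_commute)
qed

text \<open>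
  Write \<open>B\<^sub>j\<close> for the block. Multiplying it with its own reversal pairs \<open>jp + i\<close> with \<open>jp + (p - i)\<close>, whose
  product is \<open>p\<^sup>2 t + i(p - i)\<close> with \<open>t = j(j + 1)\<close>. The dependence on \<open>j\<close> thus starts at \<open>p\<^sup>2\<close>, and modulo
  \<open>p\<^sup>3\<close> only the linear term survives: \<open>B\<^sub>j\<^sup>2 = B\<^sub>0\<^sup>2 (1 + p\<^sup>2 t \<Sigma>)\<close>, where \<open>\<Sigma>\<close> is the sum of the inverses of
  \<open>i(p - i)\<close>. Modulo \<open>p\<close> these are the negated inverse squares, so \<open>p\<close> divides \<open>\<Sigma>\<close> and the squares agree.
  The square root is harmless because \<open>B\<^sub>j + B\<^sub>0 = 2B\<^sub>0\<close> modulo \<open>p\<close> is a unit.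
\<close>
lemma block_cong:
  assumes "prime p" "p > 3"
  shows "[int (block p j) = int (block p 0)] (mod int p ^ 3)"
proof -
  define P where "P = int p"
  define B where "B j = int (block p j)" for j
  define t where "t = int j * (int j + 1)"
  define g where "g i = modular_inverse (P ^ 3) (int i)" for i
  have pP: "prime P" and P3: "P > 3"
    using assms by (auto simp: P_def)
  have sq: "(B j)\<^sup>2 = (\<Prod>i\<in>{1..<p}. P\<^sup>2 * (int j * (int j + 1)) + int i * (P - int i))" for j
  proof -
    have B1: "B j = (\<Prod>i\<in>{1..<p}. int j * P + int i)"
      by (simp add: B_def block_def P_def)
    also have "\<dots> = (\<Prod>i\<in>{1..<p}. int j * P + int (p - i))"
      by (rule prod.reindex_bij_witness[of _ "\<lambda>i. p - i" "\<lambda>i. p - i"]) auto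
    also have "\<dots> = (\<Prod>i\<in>{1..<p}. int j * P + (P - int i))"
      by (intro prod.cong) (auto simp: P_def)
    finally have B2: "B j = (\<Prod>i\<in>{1..<p}. int j * P + (P - int i))" .
    have "(B j)\<^sup>2 = (\<Prod>i\<in>{1..<p}. (int j * P + int i) * (int j * P + (P - int i)))"
      by (simp only: power2_eq_square prod.distrib B1[symmetric] B2[symmetric])
    also have "\<dots> = (\<Prod>i\<in>{1..<p}. P\<^sup>2 * (int j * (int j + 1)) + int i * (P - int i))"
      by (intro prod.cong) (auto simp: algebra_simps power2_eq_square)
    finally show ?thesis .
  qed
  have sq0: "(B 0)\<^sup>2 = (\<Prod>i\<in>{1..<p}. int i * (P - int i))"
    by (subst sq) simp
  have cop: "coprime (int i) (P ^ 3)" if "i \<in> {1..<p}" for i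
  proof -
    have "\<not> p dvd i"
      using that by (auto dest: dvd_imp_le)
    hence "coprime p i"
      using assms by (simp add: prime_imp_coprime)
    thus ?thesis
      by (simp add: P_def coprime_commute)
  qed
  have g: "[int i * g i = 1] (mod P ^ 3)" if "i \<in> {1..<p}" for i
    unfolding g_def using cop[OF that] by (rule cong_modular_inverse1)
  have gP: "[int i * g i = 1] (mod P)" if "i \<in> {1..<p}" for i
    using g[OF that] by (rule cong_dvd_modulus) simp
  define b where "b i = g i * g (p - i)" for i
  have ab: "[int i * (P - int i) * b i = 1] (mod P ^ 3)" if i: "i \<in> {1..<p}" for i
  proof -
    have "int i * (P - int i) * b i = (int i * g i) * (int (p - i) * g (p - i))"
      using i by (simp add: b_def P_def)
    also have "[\<dots> = 1 * 1] (mod P ^ 3)"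
      using i by (intro cong_mult g) auto
    finally show ?thesis by simp
  qed
  have b: "[b i = - (g i)\<^sup>2] (mod P)" if i: "i \<in> {1..<p}" for i
  proof -
    have "[b i = 1 * b i] (mod P)"
      by simp
    also have "[1 * b i = (int i * g i) * b i] (mod P)"
      using gP[OF i] by (intro cong_mult cong_refl) (auto simp: cong_sym)
    also have "(int i * g i) * b i = (int i * g (p - i)) * (g i)\<^sup>2"
      by (simp add: b_def power2_eq_square)
    also have "[\<dots> = (- 1) * (g i)\<^sup>2] (mod P)"
    proof (intro cong_mult cong_refl)
      have "[int (p - i) * g (p - i) = 1] (mod P)"
        using i by (intro gP) auto
      hence "[P * g (p - i) - int (p - i) * g (p - i) = 0 - 1] (mod P)"
        by (intro cong_diff) (simp_all add: cong_0_iff)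
      moreover have "P * g (p - i) - int (p - i) * g (p - i) = int i * g (p - i)"
        using i by (simp add: P_def algebra_simps)
      ultimately show "[int i * g (p - i) = - 1] (mod P)"
        by simp
    qed
    finally show ?thesis by simp
  qed
  have "[(\<Sum>i\<in>{1..<p}. b i) = (\<Sum>i\<in>{1..<p}. - (g i)\<^sup>2)] (mod P)"
    by (intro cong_sum b)
  also have "(\<Sum>i\<in>{1..<p}. - (g i)\<^sup>2) = - (\<Sum>i\<in>{1..<p}. (g i)\<^sup>2)"
    by (rule sum_negf)
  also have "[\<dots> = - 0] (mod P)"
    unfolding cong_minus_minus_iff P_def
    by (rule sum_inverse_squares_cong_0) (use assms gP in \<open>auto simp: P_def\<close>)
  finally have "P dvd (\<Sum>i\<in>{1..<p}. b i)"
    by (simp add: cong_0_iff)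
  hence sumb: "P ^ 3 dvd P\<^sup>2 * t * (\<Sum>i\<in>{1..<p}. b i)"
    by (auto simp: power3_eq_cube power2_eq_square elim!: dvdE)

  have "(B j)\<^sup>2 = (\<Prod>i\<in>{1..<p}. P\<^sup>2 * t + int i * (P - int i))"
    by (subst sq) (simp add: t_def)
  also have "[\<dots> = (\<Prod>i\<in>{1..<p}. int i * (P - int i) * (1 + P\<^sup>2 * t * b i))] (mod P ^ 3)"
  proof (rule cong_prod)
    fix i assume "i \<in> {1..<p}"
    have "[P\<^sup>2 * t * (int i * (P - int i) * b i) + int i * (P - int i)
             = P\<^sup>2 * t * 1 + int i * (P - int i)] (mod P ^ 3)"
      by (intro cong_add cong_mult cong_refl ab) fact
    thus "[P\<^sup>2 * t + int i * (P - int i) = int i * (P - int i) * (1 + P\<^sup>2 * t * b i)] (mod P ^ 3)"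
      by (subst cong_sym_eq) (simp add: algebra_simps)
  qed
  also have "(\<Prod>i\<in>{1..<p}. int i * (P - int i) * (1 + P\<^sup>2 * t * b i)) =
             (B 0)\<^sup>2 * (\<Prod>i\<in>{1..<p}. 1 + P\<^sup>2 * t * b i)"
    by (simp only: sq0 prod.distrib)
  also have "[\<dots> = (B 0)\<^sup>2 * (1 + P\<^sup>2 * t * (\<Sum>i\<in>{1..<p}. b i))] (mod P ^ 3)"
  proof (intro cong_mult cong_refl)
    have "P ^ 3 dvd (P\<^sup>2 * t)\<^sup>2"
      by (rule dvdI[of _ _ "P * t\<^sup>2"]) (simp add: power2_eq_square power3_eq_cube)
    thus "[(\<Prod>i\<in>{1..<p}. 1 + P\<^sup>2 * t * b i) = 1 + P\<^sup>2 * t * (\<Sum>i\<in>{1..<p}. b i)] (mod P ^ 3)"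
      by (rule cong_dvd_modulus[OF cong_prod_one_plus[OF finite_atLeastLessThan]])
  qed
  also have "[(B 0)\<^sup>2 * (1 + P\<^sup>2 * t * (\<Sum>i\<in>{1..<p}. b i)) = (B 0)\<^sup>2 * (1 + 0)] (mod P ^ 3)"
    using sumb by (intro cong_mult cong_add cong_refl) (simp add: cong_0_iff)
  finally have "P ^ 3 dvd (B j)\<^sup>2 - (B 0)\<^sup>2"
    by (simp add: cong_iff_dvd_diff)
  also have "(B j)\<^sup>2 - (B 0)\<^sup>2 = (B j - B 0) * (B j + B 0)"
    by (simp add: algebra_simps power2_eq_square)
  finally have dvd: "P ^ 3 dvd (B j - B 0) * (B j + B 0)" .
  \<comment> \<open>the second factor is a unit, so the whole power of \<open>P\<close> divides the first\<close>
  have "coprime P (B j + B 0)"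
  proof -
    have "[B j = B 0] (mod P)"
      unfolding B_def block_def of_nat_prod
      by (intro cong_prod) (simp add: P_def cong_def)
    hence "[B j + B 0 = B 0 + B 0] (mod P)"
      by (intro cong_add cong_refl)
    moreover have "coprime P (B 0 + B 0)"
    proof -
      have "coprime (B 0) P"
        unfolding B_def P_def using coprime_block[OF assms(1)] by simp
      moreover have "coprime 2 P"
        using pP P3 by (intro primes_coprime) auto
      ultimately have "coprime (2 * B 0) P"
        by simp
      thus ?thesis
        by (simp only: mult_2 coprime_commute)
    qed
    ultimately show ?thesis
      using cong_imp_coprime[of "B 0 + B 0" "B j + B 0" P]
      by (simp add: cong_sym coprime_commute)
  qed
  hence "coprime (P ^ 3) (B j + B 0)"
    by simp
  hence "P ^ 3 dvd B j - B 0"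
    using dvd by (simp add: coprime_dvd_mult_left_iff)
  thus ?thesis
    by (simp add: cong_iff_dvd_diff B_def P_def)
qed

text \<open>
  Every block contributes the same unit \<open>(p - 1)!\<close>, once for each of the \<open>m + k\<close> blocks on either side.
\<close>
lemma binomial_mult_prime_cong:
  assumes "prime p" "p > 3"
  shows "[int ((m + k) * p choose (k * p)) = int ((m + k) choose k)] (mod int p ^ 3)"
proof -
  define W where "W = int (block p 0)"
  have cp: "[int (coprime_part p n) = W ^ n] (mod int p ^ 3)" for n
  proof -
    have "[(\<Prod>j<n. int (block p j)) = (\<Prod>j<n. W)] (mod int p ^ 3)"
      unfolding W_def by (intro cong_prod block_cong assms)
    thus ?thesis
      by (simp add: coprime_part_def)
  qed
  have W: "coprime (W ^ (m + k)) (int p ^ 3)"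
    using coprime_block[OF assms(1), of 0] by (simp add: W_def)
  define X where "X = int ((m + k) * p choose (k * p))"
  define Y where "Y = int ((m + k) choose k)"
  have "[X * W ^ (m + k) = X * (int (coprime_part p k) * int (coprime_part p m))] (mod int p ^ 3)"
    unfolding power_add mult.commute[of "W ^ m"]
    by (intro cong_mult cong_refl cong_sym[OF cp])
  also have "X * (int (coprime_part p k) * int (coprime_part p m)) = Y * int (coprime_part p (m + k))"
    unfolding X_def Y_def of_nat_mult[symmetric]
    using binomial_mult_coprime_part[of p m k] assms by (simp only: of_nat_eq_iff)
  also have "[\<dots> = Y * W ^ (m + k)] (mod int p ^ 3)"
    by (intro cong_mult cong_refl cp)
  finally show ?thesis
    using W by (simp add: cong_mult_rcancel X_def Y_def)
qed

section \<open>The congruence modulo 8\<close>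

text \<open>
  The odd residues modulo \<open>8\<close> multiply to \<open>1 * 3 * 5 * 7 = 105\<close>, which is \<open>1\<close> modulo \<open>8\<close>, so the product
  has period \<open>4\<close>.
\<close>
lemma coprime_part_2_mod_8:
  "coprime_part 2 n mod 8 = (if n mod 4 = 2 then 3 else if n mod 4 = 3 then 7 else 1)"
proof (induction n)
  case 0
  show ?case by (simp add: coprime_part_def)
next
  case (Suc n)
  have "{1..<2::nat} = {1}"
    by auto
  hence "coprime_part 2 (Suc n) = coprime_part 2 n * (2 * n + 1)"
    by (simp add: coprime_part_def block_def)
  moreover have "(2 * n + 1) mod 8 = 2 * (n mod 4) + 1"
    by presburger
  ultimately have "coprime_part 2 (Suc n) mod 8 =
      ((if n mod 4 = 2 then 3 else if n mod 4 = 3 then 7 else 1) * (2 * (n mod 4) + 1)) mod 8"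
    using mod_mult_eq[of "coprime_part 2 n" 8 "2 * n + 1"] by (simp add: Suc.IH)
  moreover have "n mod 4 = 0 \<and> Suc n mod 4 = 1 \<or> n mod 4 = 1 \<and> Suc n mod 4 = 2 \<or>
                 n mod 4 = 2 \<and> Suc n mod 4 = 3 \<or> n mod 4 = 3 \<and> Suc n mod 4 = 0"
    by presburger
  ultimately show ?case
    by auto
qed

text \<open>
  The factor \<open>5\<close> is \<open>Q\<^sub>2(3p) / (Q\<^sub>2(p) Q\<^sub>2(2p))\<close>, which is \<open>7 / (1 * 3)\<close> or \<open>1 / (7 * 3)\<close> according to whether
  \<open>p\<close> is \<open>1\<close> or \<open>3\<close> modulo \<open>4\<close>; both equal \<open>5\<close> modulo \<open>8\<close>.
\<close>
lemma binomial_6p_cong_mod_8: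
  assumes "odd p"
  shows "[int ((6 * p) choose (2 * p)) = 5 * int ((3 * p) choose p)] (mod 8)"
proof -
  define A where "A = int ((6 * p) choose (2 * p))"
  define B where "B = int ((3 * p) choose p)"
  define q where "q n = int (coprime_part 2 n)" for n
  have q: "[q n = (if n mod 4 = 2 then 3 else if n mod 4 = 3 then 7 else 1)] (mod 8)" for n
    using coprime_part_2_mod_8[of n] by (auto simp: q_def cong_def zmod_int[of _ 8, symmetric, simplified])
  have eq: "A * (q p * q (2 * p)) = B * q (3 * p)"
    using binomial_mult_coprime_part[of 2 "2 * p" p]
    unfolding A_def B_def q_def of_nat_mult[symmetric] by (simp add: mult_ac)
  have cong: "[B * w = A * (u * v)] (mod 8)"
    if "[q p = u] (mod 8)" "[q (2 * p) = v] (mod 8)" "[q (3 * p) = w] (mod 8)" for u v w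
  proof -
    have "[B * w = B * q (3 * p)] (mod 8)"
      by (intro cong_mult cong_refl cong_sym[OF that(3)])
    also have "[B * q (3 * p) = A * (u * v)] (mod 8)"
      unfolding eq[symmetric] by (intro cong_mult cong_refl that(1,2))
    finally show ?thesis .
  qed
  have "p mod 4 = 1 \<or> p mod 4 = 3"
    using assms by presburger
  hence "8 dvd A - 5 * B"
  proof
    assume p: "p mod 4 = 1"
    have "(2 * p) mod 4 = 2" "(3 * p) mod 4 = 3"
      using p by presburger+
    hence "[B * 7 = A * (1 * 3)] (mod 8)"
      using p q[of p] q[of "2 * p"] q[of "3 * p"] by (intro cong) simp_all
    then obtain k where "A * (1 * 3) = B * 7 + 8 * k"
      by (auto simp: cong_iff_lin)
    hence "3 * A = 7 * B + 8 * k"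
      by simp
    hence "A - 5 * B = 8 * (2 * B + 3 * k - A)"
      by (simp add: algebra_simps)
    thus ?thesis
      by (rule dvdI)
  next
    assume p: "p mod 4 = 3"
    have "(2 * p) mod 4 = 2" "(3 * p) mod 4 = 1"
      using p by presburger+
    hence "[B * 1 = A * (7 * 3)] (mod 8)"
      using p q[of p] q[of "2 * p"] q[of "3 * p"] by (intro cong) simp_all
    then obtain k where "A * (7 * 3) = B * 1 + 8 * k"
      by (auto simp: cong_iff_lin)
    hence "21 * A = B + 8 * k"
      by simp
    hence "A - 5 * B = 8 * (5 * k - 13 * A)"
      by (simp add: algebra_simps)
    thus ?thesis
      by (rule dvdI)
  qed
  thus ?thesis
    by (simp add: cong_iff_dvd_diff A_def B_def)
qed

section \<open>Binary digits and parity of binomial coefficients\<close>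

lemma even_binomial_double:
  "even ((2 * m + 2 * n) choose (2 * n)) \<longleftrightarrow> even ((m + n) choose n)"
proof -
  have odd: "odd (coprime_part 2 k)" for k
    using coprime_part_2_mod_8[of k] by presburger
  have "((m + n) * 2 choose (n * 2)) * (coprime_part 2 n * coprime_part 2 m) =
        ((m + n) choose n) * coprime_part 2 (m + n)"
    by (rule binomial_mult_coprime_part) simp
  from arg_cong[OF this, of even] show ?thesis
    using odd by (simp add: algebra_simps)
qed

lemma disjoint_bits_rec:
  fixes m n :: nat
  shows "(\<forall>j. \<not> (bit m j \<and> bit n j)) \<longleftrightarrow>
         \<not> (odd m \<and> odd n) \<and> (\<forall>j. \<not> (bit (m div 2) j \<and> bit (n div 2) j))"
proof -
  have "(\<forall>j. P j) \<longleftrightarrow> P 0 \<and> (\<forall>j. P (Suc j))" for P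
    by (metis nat.exhaust)
  from this[of "\<lambda>j. \<not> (bit m j \<and> bit n j)"] show ?thesis
    by (simp add: bit_0 bit_Suc)
qed

text \<open>
  Kummer's theorem at the prime \<open>2\<close>, by induction on the binary digits. If at most one of the last digits is
  \<open>1\<close>, the absorption identities turn the coefficient into the one for the numbers with last digits
  cleared, up to odd factors; then the last digits can be dropped. If both are \<open>1\<close>, then absorption instead
  exhibits an even factor, \<open>m + n\<close>.
\<close>
lemma odd_binomial_iff_disjoint_bits:
  fixes m n :: nat
  shows "odd ((m + n) choose n) \<longleftrightarrow> (\<forall>j. \<not> (bit m j \<and> bit n j))"
proof (induction "m + n" arbitrary: m n rule: less_induct)
  case less
  show ?case
  proof (cases "m + n = 0")
    case True
    thus ?thesis by simp
  next
    case False
    define a b where "a = m div 2" and "b = n div 2"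
    have IH: "odd ((a + b) choose b) \<longleftrightarrow> (\<forall>j. \<not> (bit a j \<and> bit b j))"
      using False by (intro less) (auto simp: a_def b_def)
    note bits = disjoint_bits_rec[of m n, folded a_def b_def]
    have half: "odd ((2 * a + 2 * b) choose (2 * b)) \<longleftrightarrow> (\<forall>j. \<not> (bit a j \<and> bit b j))"
      using IH by (simp add: even_binomial_double)
    consider "m = 2 * a" "n = 2 * b" | "m = 2 * a + 1" "n = 2 * b"
      | "m = 2 * a" "n = 2 * b + 1" | "m = 2 * a + 1" "n = 2 * b + 1"
      unfolding a_def b_def by fastforce
    thus ?thesis
    proof cases
      case 1
      thus ?thesis using half bits by simp
    next
      case 2
      have "(2 * a + 1) * (Suc (2 * a + 2 * b) choose (2 * b)) =
            Suc (2 * a + 2 * b) * ((2 * a + 2 * b) choose (2 * b))"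
        using binomial_absorb_comp[of "Suc (2 * a + 2 * b)" "2 * b"] by simp
      from arg_cong[OF this, of even]
      have "odd (Suc (2 * a + 2 * b) choose (2 * b))
              \<longleftrightarrow> odd ((2 * a + 2 * b) choose (2 * b))"
        by simp
      thus ?thesis using 2 half bits by simp
    next
      case 3
      have "(2 * b + 1) * (Suc (2 * a + 2 * b) choose (2 * b + 1)) =
            Suc (2 * a + 2 * b) * ((2 * a + 2 * b) choose (2 * b))"
        using Suc_times_binomial[of "2 * b" "2 * a + 2 * b"] by simp
      from arg_cong[OF this, of even]
      have "odd (Suc (2 * a + 2 * b) choose (2 * b + 1))
              \<longleftrightarrow> odd ((2 * a + 2 * b) choose (2 * b))"
        by simp
      thus ?thesis using 3 half bits by simp
    next
      case 4
      have "(2 * b + 1) * ((m + n) choose n) = (m + n) * ((m + n - 1) choose (2 * b))"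
        using times_binomial_minus1_eq[of n "m + n"] 4 by simp
      moreover have "even (m + n)" "odd (2 * b + 1)"
        using 4 by simp_all
      ultimately have "even ((m + n) choose n)"
        by (metis even_mult_iff)
      thus ?thesis using 4 bits by simp
    qed
  qed
qed

lemma binary_digit_sum_rec:
  "binary_digit_sum n = n mod 2 + binary_digit_sum (n div 2)"
proof -
  have fin: "finite {j. bit k j}" for k :: nat
  proof (rule finite_subset)
    show "{j. bit k j} \<subseteq> {..k}"
    proof (rule subsetI, rule ccontr)
      fix j assume j: "j \<in> {j. bit k j}" "j \<notin> {..k}"
      have "k < 2 ^ k"
        by (rule less_exp)
      also have "(2::nat) ^ k \<le> 2 ^ j"
        using j by (intro power_increasing) auto
      finally show False
        using j by (simp add: bit_iff_odd)
    qed
  qed simp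
  have "{j. bit n j} = (if odd n then {0} else {}) \<union> Suc ` {j. bit (n div 2) j}"
    (is "?L = ?R")
  proof (rule Set.set_eqI)
    fix j show "j \<in> ?L \<longleftrightarrow> j \<in> ?R"
      by (cases j) (auto simp: bit_0 bit_Suc)
  qed
  moreover have "card (Suc ` {j. bit (n div 2) j}) = binary_digit_sum (n div 2)"
    by (simp add: card_image binary_digit_sum_def)
  ultimately show ?thesis
    using fin[of "n div 2"] by (auto simp: binary_digit_sum_def card_Un_disjoint odd_iff_mod_2_eq_one)
qed

lemma binary_digit_sum_double [simp]: "binary_digit_sum (2 * n) = binary_digit_sum n"
  using binary_digit_sum_rec[of "2 * n"] by simp

lemma binary_digit_sum_double_Suc [simp]: "binary_digit_sum (Suc (2 * n)) = Suc (binary_digit_sum n)"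
  using binary_digit_sum_rec[of "Suc (2 * n)"] by simp

lemma binary_digit_sum_Suc_le: "binary_digit_sum (Suc n) \<le> Suc (binary_digit_sum n)"
proof (induction n rule: less_induct)
  case (less n)
  show ?case
  proof (cases "even n")
    case True
    thus ?thesis by (auto elim!: evenE)
  next
    case False
    then obtain k where k: "n = Suc (2 * k)" by (auto elim!: oddE)
    have "Suc n = 2 * Suc k"
      by (simp add: k)
    hence "binary_digit_sum (Suc n) = binary_digit_sum (Suc k)"
      by (metis binary_digit_sum_double)
    thus ?thesis
      using less[of k] by (simp add: k)
  qed
qed

text \<open>
  Each carry in the addition replaces two ones by a single one. The inequality is part of the statement
  because the induction needs it: after a carry out of the last digit, it is what excludes equality.
\<close>
lemma binary_digit_sum_add:
  "binary_digit_sum (m + n) \<le> binary_digit_sum m + binary_digit_sum n \<and>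
   (binary_digit_sum (m + n) = binary_digit_sum m + binary_digit_sum n
      \<longleftrightarrow> (\<forall>j. \<not> (bit m j \<and> bit n j)))"
proof (induction "m + n" arbitrary: m n rule: less_induct)
  case less
  show ?case
  proof (cases "m + n = 0")
    case True
    thus ?thesis by (simp add: binary_digit_sum_def)
  next
    case False
    define a b where "a = m div 2" and "b = n div 2"
    have IH: "binary_digit_sum (a + b) \<le> binary_digit_sum a + binary_digit_sum b \<and>
      (binary_digit_sum (a + b) = binary_digit_sum a + binary_digit_sum b
        \<longleftrightarrow> (\<forall>j. \<not> (bit a j \<and> bit b j)))"
      using False by (intro less) (auto simp: a_def b_def)
    note bits = disjoint_bits_rec[of m n, folded a_def b_def]
    have dbl: "binary_digit_sum (2 * a + 2 * b) = binary_digit_sum (a + b)"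
      by (metis binary_digit_sum_double distrib_left)
    have dbl': "binary_digit_sum (Suc (2 * a + 2 * b)) = Suc (binary_digit_sum (a + b))"
      by (metis binary_digit_sum_double_Suc distrib_left)
    consider "m = 2 * a" "n = 2 * b" | "m = Suc (2 * a)" "n = 2 * b"
      | "m = 2 * a" "n = Suc (2 * b)" | "m = Suc (2 * a)" "n = Suc (2 * b)"
      unfolding a_def b_def by fastforce
    thus ?thesis
    proof cases
      case 4
      have "m + n = 2 * Suc (a + b)"
        using 4 by simp
      hence "binary_digit_sum (m + n) = binary_digit_sum (Suc (a + b))"
        by (metis binary_digit_sum_double)
      also have "\<dots> \<le> Suc (binary_digit_sum (a + b))"
        by (rule binary_digit_sum_Suc_le)
      finally have "binary_digit_sum (m + n) < binary_digit_sum m + binary_digit_sum n"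
        using IH 4 by simp
      moreover have "odd m \<and> odd n"
        using 4 by simp
      ultimately show ?thesis
        using bits by simp
    qed (use IH dbl dbl' bits in simp_all)
  qed
qed

text \<open>
  Adjacent ones of \<open>p\<close> are common ones of \<open>p\<close> and of its shift \<open>2p\<close>.
\<close>
lemma well_spaced_iff_odd_binomial:
  "well_spaced p \<longleftrightarrow> odd ((3 * p) choose p)"
proof -
  have "odd ((2 * p + p) choose p) \<longleftrightarrow> (\<forall>j. \<not> (bit (2 * p) j \<and> bit p j))"
    by (rule odd_binomial_iff_disjoint_bits)
  also have "\<dots> \<longleftrightarrow> well_spaced p"
  proof -
    have "(\<forall>j. P j) \<longleftrightarrow> P 0 \<and> (\<forall>j. P (Suc j))" for P
      by (metis nat.exhaust)
    from this[of "\<lambda>j. \<not> (bit (2 * p) j \<and> bit p j)"] show ?thesis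
      by (auto simp: well_spaced_def bit_0 bit_Suc)
  qed
  finally show ?thesis
    by simp
qed

lemma digit_sum_condition_iff_well_spaced:
  assumes "odd p"
  shows "2 * binary_digit_sum p = binary_digit_sum (3 * p - 1) + 1 \<longleftrightarrow> well_spaced p"
proof -
  obtain k where k: "3 * p = Suc (2 * k)"
    using assms by (elim oddE) (auto intro: that[of "3 * _ + 1"])
  hence "binary_digit_sum (3 * p) = binary_digit_sum (3 * p - 1) + 1"
    by simp
  moreover have "binary_digit_sum (2 * p + p) = binary_digit_sum (2 * p) + binary_digit_sum p
                   \<longleftrightarrow> odd ((2 * p + p) choose p)"
    using binary_digit_sum_add[of "2 * p" p] odd_binomial_iff_disjoint_bits[of "2 * p" p] by blast
  ultimately show ?thesis
    unfolding well_spaced_iff_odd_binomial by auto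
qed

section \<open>The Moebius sum\<close>

lemma moebius_mu_1 [simp]: "moebius_mu (Suc 0) = 1"
  by (simp add: moebius_mu_def)

lemma moebius_mu_prime:
  assumes "prime p"
  shows "moebius_mu p = -1"
  using assms by (simp add: moebius_mu_def squarefree_prime prime_prime_factors)

lemma moebius_mu_mult_primes:
  assumes "prime p" "prime q" "p \<noteq> q"
  shows "moebius_mu (p * q) = 1"
proof -
  have "coprime p q"
    using assms by (rule primes_coprime)
  hence "squarefree (p * q)"
    using assms by (intro squarefree_mult_coprime squarefree_prime)
  moreover have "prime_factors (p * q) = {p, q}"
    using assms by (subst prime_factors_product) (auto simp: prime_prime_factors)
  ultimately show ?thesis
    using assms(3) by (simp add: moebius_mu_def)
qed

lemma n_num_div_in_Ints_iff:
  assumes "r > 0"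
  shows "n_num r / of_nat r \<in> \<int> \<longleftrightarrow>
    int r ^ 3 dvd (\<Sum>d | d dvd r. moebius_mu (r div d) * int ((3 * d - 1) choose (d - 1)))"
    (is "_ \<longleftrightarrow> _ dvd ?S")
proof -
  have "n_num r / of_nat r = of_int ?S / of_int (int r ^ 3)"
    by (simp add: n_num_def power2_eq_square power3_eq_cube)
  thus ?thesis
    using assms by (simp only: of_int_div_of_int_in_Ints_iff) simp
qed

lemma moebius_sum_twice_prime:
  assumes "prime p" "p \<noteq> 2"
  shows "(\<Sum>d | d dvd 2 * p. moebius_mu (2 * p div d) * int ((3 * d - 1) choose (d - 1)))
         = int ((6 * p - 1) choose (2 * p - 1)) - int ((3 * p - 1) choose (p - 1)) - 4"
proof -
  have "{d. d dvd 2 * p} = {1, 2, p, 2 * p}"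
  proof (intro equalityI subsetI)
    fix d assume "d \<in> {d. d dvd 2 * p}"
    then obtain a b where d: "d = a * b" "a dvd 2" "b dvd p"
      using division_decomp[of d 2 p] by auto
    have "a = 1 \<or> a = 2" "b = 1 \<or> b = p"
      using d assms by (auto simp: prime_nat_iff
          dest: prime_nat_iff[THEN iffD1, OF two_is_prime_nat, THEN conjunct2, rule_format])
    thus "d \<in> {1, 2, p, 2 * p}"
      using d by auto
  qed auto
  moreover have "p > 2"
    using assms prime_gt_1_nat[of p] by simp
  ultimately show ?thesis
    using assms moebius_mu_mult_primes[of 2 p]
    by (simp add: moebius_mu_prime)
qed

lemma binomial_triple_pred:
  assumes "d > 0"
  shows "((3 * d) choose d) = 3 * ((3 * d - 1) choose (d - 1))"
proof -
  have "d * ((3 * d) choose d) = d * (3 * ((3 * d - 1) choose (d - 1)))"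
    using times_binomial_minus1_eq[OF assms, of "3 * d"] by (simp only: mult.assoc mult.left_commute)
  thus ?thesis
    by (simp only: nat_mult_eq_cancel1[OF assms])
qed

text \<open>
  The two binomial coefficients are \<open>binom(6, 2) / 3 = 5\<close> and \<open>binom(3, 1) / 3 = 1\<close> modulo \<open>p\<^sup>3\<close>, and
  \<open>5 - 1 - 4 = 0\<close>.
\<close>
lemma cube_dvd_moebius_sum:
  assumes "prime p" "p > 3"
  shows "int p ^ 3 dvd int ((6 * p - 1) choose (2 * p - 1)) - int ((3 * p - 1) choose (p - 1)) - 4"
proof -
  define A where "A = int ((6 * p - 1) choose (2 * p - 1))"
  define B where "B = int ((3 * p - 1) choose (p - 1))"
  have A3: "int ((6 * p) choose (2 * p)) = 3 * A"
    using binomial_triple_pred[of "2 * p"] assms by (simp add: A_def)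
  have B3: "int ((3 * p) choose p) = 3 * B"
    using binomial_triple_pred[of "p"] assms by (simp add: B_def)
  have "[3 * A = 15] (mod int p ^ 3)"
    using binomial_mult_prime_cong[OF assms, of 4 2] by (simp add: A3 choose_two)
  moreover have "[3 * B = 3] (mod int p ^ 3)"
    using binomial_mult_prime_cong[OF assms, of 2 1] by (simp add: B3)
  ultimately have "[3 * A - 3 * B - 12 = 15 - 3 - 12] (mod int p ^ 3)"
    by (intro cong_diff cong_refl)
  hence "int p ^ 3 dvd 3 * (A - B - 4)"
    by (simp add: cong_0_iff algebra_simps)
  moreover have "coprime (int p ^ 3) 3"
  proof -
    have "coprime p 3"
      using assms by (intro primes_coprime) auto
    hence "coprime (int p) (int 3)"
      by (simp only: coprime_int_iff)
    thus ?thesis by simp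
  qed
  ultimately have "int p ^ 3 dvd A - B - 4"
    by (simp only: coprime_dvd_mult_right_iff)
  thus ?thesis
    by (simp only: A_def B_def)
qed

lemma eight_dvd_moebius_sum_iff:
  assumes "odd p"
  shows "8 dvd int ((6 * p - 1) choose (2 * p - 1)) - int ((3 * p - 1) choose (p - 1)) - 4
         \<longleftrightarrow> well_spaced p"
proof -
  define A where "A = ((6 * p - 1) choose (2 * p - 1))"
  define B where "B = ((3 * p - 1) choose (p - 1))"
  have p: "p > 0"
    using assms by (rule odd_pos)
  have A3: "((6 * p) choose (2 * p)) = 3 * A"
    using binomial_triple_pred[of "2 * p"] p by (simp add: A_def)
  have B3: "((3 * p) choose p) = 3 * B"
    using binomial_triple_pred[of "p"] p by (simp add: B_def)
  have "[int (3 * A) = 5 * int (3 * B)] (mod 8)"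
    using binomial_6p_cong_mod_8[OF assms] by (simp only: A3 B3)
  hence "8 dvd 3 * (int A - 5 * int B)"
    by (simp add: cong_iff_dvd_diff algebra_simps)
  moreover have "coprime (8::int) 3"
    by (simp add: coprime_iff_gcd_eq_1 gcd_non_0_int)
  ultimately have "8 dvd int A - 5 * int B"
    by (simp only: coprime_dvd_mult_right_iff)
  moreover have "int A - int B - 4 = (int A - 5 * int B) + 4 * (int B - 1)"
    by simp
  ultimately have "8 dvd int A - int B - 4 \<longleftrightarrow> 4 * 2 dvd 4 * (int B - 1)"
    by (simp only: dvd_add_right_iff) simp
  also have "\<dots> \<longleftrightarrow> odd B"
    by (subst dvd_mult_cancel_left) simp
  also have "odd B \<longleftrightarrow> well_spaced p"
    unfolding well_spaced_iff_odd_binomial B3 by simp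
  finally show ?thesis
    by (simp only: A_def B_def)
qed

section \<open>Integrality in terms of binary digits\<close>

text \<open>
  The prime \<open>2\<close>: the quotient is \<open>(165 - 5) / 64\<close>. Since \<open>2\<close> is well-spaced, it is the exception to the
  converse in the main result.
\<close>
lemma n_num_4_not_in_Ints: "n_num 4 / of_nat 4 \<notin> \<int>"
proof -
  have "{d::nat. d dvd 4} = {1, 2, 4}"
  proof (intro equalityI subsetI)
    fix d :: nat assume d: "d \<in> {d. d dvd 4}"
    hence "d \<le> 4" by (auto dest: dvd_imp_le)
    hence "d = 0 \<or> d = 1 \<or> d = 2 \<or> d = 3 \<or> d = 4" by arith
    thus "d \<in> {1, 2, 4}" using d by auto
  qed auto
  moreover have "moebius_mu 4 = 0"
    using not_squarefreeI[of 2 "4::nat"] by (simp add: moebius_mu_def)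
  moreover have "(11 choose 3) = (165::nat)"
    by (simp add: numeral_eq_Suc)
  ultimately show ?thesis
    by (subst n_num_div_in_Ints_iff) (simp_all add: moebius_mu_prime)
qed

theorem mainTheorem2:
  fixes p :: nat
  assumes "prime p"
  shows "(n_num (2 * p) / of_nat (2 * p) \<in> \<int>
            \<longleftrightarrow> 2 * binary_digit_sum p = binary_digit_sum (3 * p - 1) + 1)
       \<and> (2 * binary_digit_sum p = binary_digit_sum (3 * p - 1) + 1 \<longrightarrow> well_spaced p)
       \<and> (p \<noteq> 2 \<longrightarrow> well_spaced p \<longrightarrow> 2 * binary_digit_sum p = binary_digit_sum (3 * p - 1) + 1)"
proof (cases "p = 2")
  case True
  have "binary_digit_sum 1 = 1"
    by (subst binary_digit_sum_rec) (simp add: binary_digit_sum_def)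
  hence "binary_digit_sum 2 = 1" "binary_digit_sum 5 = 2"
    using binary_digit_sum_double[of 1] binary_digit_sum_rec[of 5] by simp_all
  thus ?thesis
    using n_num_4_not_in_Ints True by simp
next
  case False
  hence odd: "odd p"
    using assms by (metis primes_dvd_imp_eq two_is_prime_nat)
  define S where
    "S = int ((6 * p - 1) choose (2 * p - 1)) - int ((3 * p - 1) choose (p - 1)) - 4"
  have "n_num (2 * p) / of_nat (2 * p) \<in> \<int> \<longleftrightarrow> 8 * int p ^ 3 dvd S"
    using n_num_div_in_Ints_iff[of "2 * p"] prime_gt_0_nat[OF assms]
    unfolding moebius_sum_twice_prime[OF assms False] S_def by (simp add: power_mult_distrib)
  also have "\<dots> \<longleftrightarrow> 8 dvd S"
  proof (cases "p = 3")
    case True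
    \<comment> \<open>\<open>3\<close> is binary \<open>11\<close>; so already \<open>8\<close> does not divide \<open>S\<close>\<close>
    have "\<not> well_spaced 3"
      unfolding well_spaced_def by (auto intro!: exI[of _ 0] simp: bit_0 bit_Suc)
    hence "\<not> 8 dvd S"
      using eight_dvd_moebius_sum_iff[OF odd] True by (simp add: S_def)
    thus ?thesis
      by (auto dest: dvd_mult_left)
  next
    case p3: False
    have "p > 3"
      using False p3 prime_gt_1_nat[OF assms] by simp
    hence "int p ^ 3 dvd S"
      unfolding S_def by (intro cube_dvd_moebius_sum assms)
    moreover have "coprime (8::int) (int p ^ 3)"
    proof -
      have "coprime (2::int) (int p)"
        using odd by simp
      hence "coprime ((2::int) ^ 3) (int p ^ 3)"
        by (simp only: coprime_power_left_iff coprime_power_right_iff) simp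
      moreover have "(2::int) ^ 3 = 8"
        by simp
      ultimately show ?thesis
        by (simp only:)
    qed
    ultimately show ?thesis
      by (meson divides_mult dvd_mult_left)
  qed
  also have "\<dots> \<longleftrightarrow> well_spaced p"
    unfolding S_def by (rule eight_dvd_moebius_sum_iff[OF odd])
  finally show ?thesis
    using digit_sum_condition_iff_well_spaced[OF odd] by blast
qed

end
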